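(* Let $\mathcal{A}$ be a nonzero nilpotent (finite-dimensional left) Leibniz algebra over a field $F$. Then $\mathcal{A}$ is not complete.
   Context: All Leibniz algebras are finite-dimensional left Leibniz algebras: vector spaces $\mathcal{A}$ over a field $F$ with a bilinear product $[\,,\,]$ such that every left multiplication operator $L_x(y)=[x,y]$ is a derivation of the product, i.e. $[x,[y,z]]=[[x,y],z]+[y,[x,z]]$. A linear map $\delta:\mathcal{A}\to\mathcal{A}$ is a derivation if $\delta([x,y])=[\delta(x),y]+[x,\delta(y)]$ for all $x,y$; $Der(\mathcal{A})$ denotes the Lie algebra of all derivations. $\mathrm{Leib}(\mathcal{A})=\mathrm{span}\{[x,x]\mid x\in\mathcal{A}\}$, which is an abelian ideal, and $\mathcal{A}/\mathrm{Leib}(\mathcal{A})$ is a Lie algebra. $\mathcal{A}$ is nilpotent if $\mathcal{A}^{m}=\{0\}$ for some positive integer $m$, where $\mathcal{A}^{1}=\mathcal{A}$, $\mathcal{A}^{i}=[\mathcal{A},\mathcal{A}^{i-1}]$. A derivation $\delta\in Der(\mathcal{A})$ is inner if there exists $x\in\mathcal{A}$ with $\mathrm{im}(\delta-L_x)\subseteq\mathrm{Leib}(\mathcal{A})$. $\mathcal{A}$ is complete if (1) the center $Z(\mathcal{A}/\mathrm{Leib}(\mathcal{A}))$ of the Lie algebra $\mathcal{A}/\mathrm{Leib}(\mathcal{A})$ is $\{0\}$, and (2) every derivation of $\mathcal{A}$ is inner (in the sense just defined). *)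

theory Defs
  imports Main "HOL.Vector_Spaces"
begin

text \<open>Left Leibniz algebras over a field, finite-dimensional throughout. As in the library locale
  \<^locale>\<open>vector_space\<close>, the type \<^typ>\<open>'b\<close> is the whole underlying space.\<close>

locale leibniz_algebra = vector_space scale
  for scale :: "'a::field \<Rightarrow> 'b::ab_group_add \<Rightarrow> 'b" (infixr \<open>*s\<close> 75) +
  fixes br :: "'b \<Rightarrow> 'b \<Rightarrow> 'b"
  assumes finite_dim: "\<exists>B. finite B \<and> span B = UNIV"
    and linear_br_left: "Vector_Spaces.linear scale scale (\<lambda>x. br x y)"
    and linear_br_right: "Vector_Spaces.linear scale scale (\<lambda>y. br x y)"
    and left_leibniz: "br x (br y z) = br (br x y) z + br y (br x z)"
begin

definition Der :: "('b \<Rightarrow> 'b) set" where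
  "Der = {\<delta>. Vector_Spaces.linear scale scale \<delta> \<and> (\<forall>x y. \<delta> (br x y) = br (\<delta> x) y + br x (\<delta> y))}"

definition Leib :: "'b set" where
  "Leib = span {br x x | x. True}"

text \<open>The product of two subspaces is the span of the products of their elements.\<close>

definition subspace_br :: "'b set \<Rightarrow> 'b set \<Rightarrow> 'b set" where
  "subspace_br U V = span {br u v | u v. u \<in> U \<and> v \<in> V}"

text \<open>\<open>lower_central i\<close> is the $i$-th power of the algebra, indexed from 1; the value at 0 is
  irrelevant.\<close>

fun lower_central :: "nat \<Rightarrow> 'b set" where
  "lower_central 0 = UNIV"
| "lower_central (Suc 0) = UNIV"
| "lower_central (Suc (Suc i)) = subspace_br UNIV (lower_central (Suc i))"

definition nilpotent :: bool where
  "nilpotent \<longleftrightarrow> (\<exists>m>0. lower_central m = {0})"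

definition inner_derivation :: "('b \<Rightarrow> 'b) \<Rightarrow> bool" where
  "inner_derivation \<delta> \<longleftrightarrow> \<delta> \<in> Der \<and> (\<exists>x. range (\<lambda>y. \<delta> y - br x y) \<subseteq> Leib)"

text \<open>The quotient by \<open>Leib\<close> is realised on the set of cosets; its zero is the coset \<open>Leib\<close>.
  The bracket is the union of the cosets of the brackets of all representatives; by
  \<open>quot_br_coset\<close> below these all coincide.\<close>

definition coset :: "'b \<Rightarrow> 'b set" where
  "coset x = (\<lambda>l. x + l) ` Leib"

definition quot :: "'b set set" where
  "quot = range coset"

definition quot_br :: "'b set \<Rightarrow> 'b set \<Rightarrow> 'b set" where
  "quot_br C D = (\<Union>x\<in>C. \<Union>y\<in>D. coset (br x y))"

definition quot_center :: "'b set set" where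
  "quot_center = {Z \<in> quot. \<forall>C \<in> quot. quot_br Z C = Leib \<and> quot_br C Z = Leib}"

definition complete :: bool where
  "complete \<longleftrightarrow> quot_center = {Leib} \<and> (\<forall>\<delta>\<in>Der. inner_derivation \<delta>)"

lemma br_add_left: "br (x + y) z = br x z + br y z"
  using linear_br_left by (simp add: Vector_Spaces.linear_iff)

lemma br_add_right: "br z (x + y) = br z x + br z y"
  using linear_br_right by (simp add: Vector_Spaces.linear_iff)

lemma br_scale_left: "br (c *s x) z = c *s br x z"
  using linear_br_left by (simp add: Vector_Spaces.linear_iff)

lemma br_scale_right: "br z (c *s x) = c *s br z x"
  using linear_br_right by (simp add: Vector_Spaces.linear_iff)

lemma br_zero_left: "br 0 z = 0"
  using br_add_left[of 0 0 z] by simp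

lemma br_zero_right: "br z 0 = 0"
  using br_add_right[of z 0 0] by simp

lemma br_Leib_left:
  assumes "l \<in> Leib"
  shows "br l z = 0"
  using assms unfolding Leib_def
proof (induction rule: span_induct_alt)
  case base
  then show ?case by (rule br_zero_left)
next
  case (step c x y)
  then obtain w where "x = br w w" by blast
  moreover have "br (br w w) z = 0"
    using left_leibniz[of w w z] by (metis add_cancel_left_left)
  ultimately show ?case
    using step.IH by (simp only: br_add_left br_scale_left scale_zero_right add_0_right)
qed

lemma br_Leib_right:
  assumes "l \<in> Leib"
  shows "br z l \<in> Leib"
  using assms unfolding Leib_def
proof (induction rule: span_induct_alt)
  case base
  then show ?case by (simp add: br_zero_right span_zero)
next
  case (step c x y)
  then obtain w where w: "x = br w w" by blast
  let ?S = "{br x x |x. True}"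
  have gen: "br u u \<in> span ?S" for u by (rule span_base) blast
  let ?u = "br z w"
  have "br z x = br (?u + w) (?u + w) - br ?u ?u - br w w"
    by (simp add: w left_leibniz[of z w w] br_add_left br_add_right algebra_simps)
  then have "br z x \<in> span ?S"
    by (simp only: gen span_diff)
  with step show ?case
    by (simp add: br_add_right br_scale_right span_add span_scale)
qed

lemma coset_eq_iff: "coset x = coset y \<longleftrightarrow> x - y \<in> Leib"
proof
  assume "coset x = coset y"
  moreover have "x \<in> coset x"
    unfolding coset_def Leib_def by (rule image_eqI[of _ _ 0]) (simp_all add: span_zero)
  ultimately show "x - y \<in> Leib"
    unfolding coset_def by auto
next
  have sub: "coset a \<subseteq> coset b" if "a - b \<in> Leib" for a b
  proof
    fix v assume "v \<in> coset a"
    then obtain l where l: "l \<in> Leib" "v = a + l" unfolding coset_def by blast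
    have "(a - b) + l \<in> Leib" using that l(1) unfolding Leib_def by (rule span_add)
    then show "v \<in> coset b" unfolding coset_def l(2) by (rule rev_image_eqI) simp
  qed
  assume *: "x - y \<in> Leib"
  then have "y - x \<in> Leib" unfolding Leib_def by (metis minus_diff_eq span_neg)
  with * show "coset x = coset y" using sub by blast
qed

lemma coset_zero: "coset 0 = Leib"
  by (simp add: coset_def)

lemma quot_br_coset: "quot_br (coset x) (coset y) = coset (br x y)"
proof -
  have "coset (br (x + l) (y + m)) = coset (br x y)" if "l \<in> Leib" "m \<in> Leib" for l m
    unfolding coset_eq_iff
    using that by (simp add: br_add_left br_add_right br_Leib_left br_Leib_right)
  moreover have "0 \<in> Leib" unfolding Leib_def by (rule span_zero)
  ultimately show ?thesis
    unfolding quot_br_def by (auto simp: coset_def[of x] coset_def[of y])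
qed

end

end

theory Submission
  imports Defs
begin

text \<open>The completeness of a nonzero nilpotent algebra already fails at the centre of the quotient.
  If \<open>Leib\<close> is not everything, the last power of the algebra not contained in \<open>Leib\<close>
  is central modulo \<open>Leib\<close>: left multiplications map it into the next power, and modulo
  \<open>Leib\<close> the bracket is antisymmetric. If \<open>Leib\<close> is everything, then the bracket
  vanishes, because \<open>Leib\<close> annihilates from the left; hence \<open>Leib\<close>, and with it the
  algebra, is zero.\<close>

context leibniz_algebra
begin

lemma square_in_Leib: "br x x \<in> Leib"
  unfolding Leib_def by (rule span_base) blast

text \<open>Polarisation: \<open>br x y + br y x\<close> is a combination of squares, so it lies in
  \<open>Leib\<close>.\<close>

lemma br_swap_in_Leib:
  assumes "br x y \<in> Leib"
  shows "br y x \<in> Leib"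
proof -
  have "br y x = br (x + y) (x + y) - br x x - br y y - br x y"
    by (simp add: br_add_left br_add_right)
  moreover have "\<dots> \<in> Leib"
    using assms square_in_Leib unfolding Leib_def by (intro span_diff) auto
  ultimately show ?thesis
    by simp
qed

text \<open>The powers are built by left multiplication, so they control only \<open>br u z\<close>;
  antisymmetry modulo \<open>Leib\<close> supplies the other side.\<close>

lemma coset_in_quot_center:
  assumes "\<And>u. br u z \<in> Leib"
  shows "coset z \<in> quot_center"
proof -
  have "coset (br z u) = Leib" "coset (br u z) = Leib" for u
    using assms br_swap_in_Leib coset_eq_iff[of _ 0] by (simp_all add: coset_zero)
  then show ?thesis
    by (auto simp: quot_center_def quot_def quot_br_coset)
qed

lemma Leib_UNIV_imp_trivial:
  assumes "Leib = UNIV"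
  shows "(UNIV :: 'b set) = {0}"
proof -
  have "br x y = 0" for x y
    using br_Leib_left[of x y] assms by simp
  then have "Leib = span {0}"
    by (simp add: Leib_def)
  then show ?thesis
    using assms by (simp add: span_insert_0)
qed

lemma nilpotent_quot_center_trivial:
  assumes "nilpotent" and "quot_center = {Leib}"
  shows "(UNIV :: 'b set) = {0}"
proof -
  have step: "lower_central (Suc n) \<subseteq> Leib" if "lower_central (Suc (Suc n)) \<subseteq> Leib" for n
  proof
    fix z assume z: "z \<in> lower_central (Suc n)"
    have "br u z \<in> lower_central (Suc (Suc n))" for u
      using z by (auto simp: subspace_br_def intro: span_base)
    with that have "coset z \<in> quot_center"
      by (intro coset_in_quot_center) blast
    with assms(2) show "z \<in> Leib"
      using coset_eq_iff[of z 0] by (simp add: coset_zero)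
  qed
  obtain n where n: "lower_central (Suc n) = {0}"
    using assms(1) unfolding nilpotent_def by (metis Suc_pred)
  \<comment> \<open>Containment in \<open>Leib\<close> passes from the vanishing power down to the
    first power, which is the whole algebra.\<close>
  have "lower_central (Suc n) \<subseteq> Leib \<Longrightarrow> lower_central (Suc 0) \<subseteq> Leib"
    by (induction n) (use step in blast)+
  with n have "Leib = UNIV"
    by (auto simp: Leib_def span_zero)
  then show ?thesis
    by (rule Leib_UNIV_imp_trivial)
qed

end

theorem proposition3p4:
  fixes scale :: "'a::field \<Rightarrow> 'b::ab_group_add \<Rightarrow> 'b"
    and br :: "'b \<Rightarrow> 'b \<Rightarrow> 'b"
  assumes "leibniz_algebra scale br"
    and "(UNIV :: 'b set) \<noteq> {0}"
    and "leibniz_algebra.nilpotent scale br"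
  shows "\<not> leibniz_algebra.complete scale br"
proof -
  interpret leibniz_algebra scale br
    by (rule assms(1))
  show ?thesis
    using assms(2,3) nilpotent_quot_center_trivial unfolding complete_def by blast
qed

end
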